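(* Let $d_1,d_2$ be positive integers, $A\subseteq\mathbb{Z}^{d_1}$ and $B\subseteq\mathbb{Z}^{d_2}$, and regard $A\times B$ as a subset of $\mathbb{Z}^{d_1+d_2}$. Then \begin{align*} \dim_\zeta(A)+\dim_\zeta(B)&\leq \dim_\zeta(A\times B)\\ &\leq \dim_\zeta(A)+\mathrm{Dim}_\zeta(B)\\ &\leq \mathrm{Dim}_\zeta(A\times B)\\ &\leq \mathrm{Dim}_\zeta(A)+\mathrm{Dim}_\zeta(B). \end{align*}
   Context: For $\vec{n}=(n_1,\dots,n_d)\in\mathbb{Z}^d$, $\|\vec{n}\|=\sqrt{n_1^2+\cdots+n_d^2}$. For $A\subseteq\mathbb{Z}^d$ and $I\subseteq[0,\infty)$, $A_I=\{\vec{n}\in A\mid \|\vec{n}\|\in I\}$. For $A\subseteq\mathbb{Z}^d$, $\zeta_A(s)=\sum_{\vec{0}\neq\vec{n}\in A}\|\vec{n}\|^{-s}$ for real $s\ge0$, and the (upper) zeta-dimension is $\mathrm{Dim}_\zeta(A)=\inf\{s\ge0\mid\zeta_A(s)<\infty\}$; equivalently $\mathrm{Dim}_\zeta(A)=\limsup_{n\to\infty}\frac{\log|A_{[1,n]}|}{\log n}$. The lower zeta-dimension of $A\subseteq\mathbb{Z}^d$ is $\dim_\zeta(A)=\liminf_{n\to\infty}\frac{\log|A_{[1,n]}|}{\log n}$. Logarithms are base 2.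
   Formalization: A and B are assumed nonempty, with log 0 read as 0 (as the equivalence of the two forms of the upper dimension requires); for A empty and B = Z the first inequality would read 0 + 1 ≤ 0, which is false. *)

theory Defs
  imports "HOL-Analysis.Analysis"
begin

text \<open>
  Points of \<open>\<int>\<^sup>d\<close> are vectors of type \<open>int ^ 'n\<close> with \<open>d = CARD('n)\<close>; index types are nonempty,
  so \<open>d > 0\<close>.
\<close>

definition lattice_norm :: "int ^ 'n \<Rightarrow> real" where
  "lattice_norm v = sqrt (\<Sum>i\<in>UNIV. (real_of_int (v $ i))\<^sup>2)"

definition norm_part :: "(int ^ 'n) set \<Rightarrow> real set \<Rightarrow> (int ^ 'n) set" where
  "norm_part A I = {v \<in> A. lattice_norm v \<in> I}"

definition zeta_fun :: "(int ^ 'n) set \<Rightarrow> real \<Rightarrow> ennreal" where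
  "zeta_fun A s = (\<Sum>\<^sub>\<infinity>v\<in>A - {0}. ennreal (lattice_norm v powr (- s)))"

definition upper_zeta_dim :: "(int ^ 'n) set \<Rightarrow> ereal" where
  "upper_zeta_dim A = Inf {ereal s | s. 0 \<le> s \<and> zeta_fun A s < \<infinity>}"

text \<open>
  If \<open>A \<subseteq> {0}\<close>, the counting set is empty for every \<open>n\<close> and \<open>log 2 0 = 0\<close> gives lower dimension 0.
  This is the only convention under which the upper dimension is the corresponding limes superior
  for such \<open>A\<close> too.
\<close>

definition lower_zeta_dim :: "(int ^ 'n) set \<Rightarrow> ereal" where
  "lower_zeta_dim A =
    liminf (\<lambda>n::nat. ereal (log 2 (real (card (norm_part A {1..real n}))) / log 2 (real n)))"

text \<open>
  The product lives in \<open>\<int>\<^sup>d\<close> with \<open>d = d\<^sub>1 + d\<^sub>2\<close>: the sum type \<open>'m + 'n\<close> has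
  \<open>CARD('m) + CARD('n)\<close> elements and indexes the concatenated coordinates.
\<close>

definition vec_append :: "int ^ 'm \<Rightarrow> int ^ 'n \<Rightarrow> int ^ ('m + 'n)" where
  "vec_append x y = (\<chi> i. case i of Inl j \<Rightarrow> x $ j | Inr k \<Rightarrow> y $ k)"

definition lattice_prod :: "(int ^ 'm) set \<Rightarrow> (int ^ 'n) set \<Rightarrow> (int ^ ('m + 'n)) set" where
  "lattice_prod A B = {vec_append x y | x y. x \<in> A \<and> y \<in> B}"

end

theory Submission
  imports Defs
begin

text \<open>
  Counting all points of norm at most \<open>r\<close>, the origin included, makes the counting function nearly
  multiplicative: \<open>c\<^sub>A(r) c\<^sub>B(r) \<le> c\<^sub>A\<^sub>\<times>\<^sub>B(2r)\<close> and \<open>c\<^sub>A\<^sub>\<times>\<^sub>B(r) \<le> c\<^sub>A(r) c\<^sub>B(r)\<close>. Both dimensions are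
  growth exponents of this function, insensitive to constant factors: for the lower one this is
  immediate, for the upper one it follows by comparing the zeta series with the dyadic series
  \<open>\<Sum>\<^sub>k 2\<^sup>-\<^sup>k\<^sup>s c\<^sub>A(2\<^sup>k)\<close>. The four inequalities then reduce to multiplying power bounds.
\<close>

definition ball_count :: "(int ^ 'n) set \<Rightarrow> real \<Rightarrow> nat" where
  "ball_count A r = card (norm_part A {..r})"

section \<open>Lattice norm and counting function\<close>

lemma lattice_norm_nonneg [simp]: "0 \<le> lattice_norm v"
  by (simp add: lattice_norm_def sum_nonneg)

lemma lattice_norm_zero [simp]: "lattice_norm 0 = 0"
  by (simp add: lattice_norm_def)

lemma component_le_lattice_norm: "\<bar>real_of_int (v $ i)\<bar> \<le> lattice_norm v"
proof -
  have "(real_of_int (v $ i))\<^sup>2 \<le> (\<Sum>i\<in>UNIV. (real_of_int (v $ i))\<^sup>2)"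
    by (rule member_le_sum) auto
  then show ?thesis
    unfolding lattice_norm_def by (metis real_sqrt_abs real_sqrt_le_iff)
qed

text \<open>A nonzero integer coordinate has absolute value at least 1. Hence cutting
  \<open>{..r}\<close> down to \<open>{1..r}\<close> removes at most the origin, and the two counts
  differ by at most 1.\<close>

lemma one_le_lattice_norm_iff: "1 \<le> lattice_norm v \<longleftrightarrow> v \<noteq> 0"
proof
  assume "v \<noteq> 0"
  then obtain i where "v $ i \<noteq> 0" by (auto simp: vec_eq_iff)
  then have "1 \<le> \<bar>real_of_int (v $ i)\<bar>" by linarith
  then show "1 \<le> lattice_norm v" using component_le_lattice_norm[of v i] by linarith
qed auto

lemma finite_norm_part_atMost [simp]: "finite (norm_part A {..r})"
proof -
  let ?S = "{- \<lceil>r\<rceil>..\<lceil>r\<rceil>}"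
  have "vec_nth ` norm_part A {..r} \<subseteq> UNIV \<rightarrow>\<^sub>E ?S"
  proof (rule image_subsetI)
    fix v assume v: "v \<in> norm_part A {..r}"
    have "v $ i \<in> ?S" for i
    proof -
      have "\<bar>real_of_int (v $ i)\<bar> \<le> r"
        using v component_le_lattice_norm[of v i] by (simp add: norm_part_def)
      then show ?thesis by simp linarith
    qed
    then show "vec_nth v \<in> UNIV \<rightarrow>\<^sub>E ?S" by auto
  qed
  moreover have "finite ((UNIV :: 'a set) \<rightarrow>\<^sub>E ?S)" by (intro finite_PiE) auto
  ultimately have "finite (vec_nth ` norm_part A {..r})" by (rule finite_subset)
  then show ?thesis by (rule finite_imageD) (simp add: inj_on_def vec_nth_inject)
qed

lemma ball_count_mono: "r \<le> r' \<Longrightarrow> ball_count A r \<le> ball_count A r'"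
  unfolding ball_count_def by (rule card_mono[OF finite_norm_part_atMost]) (auto simp: norm_part_def)

lemma eventually_ball_count_pos:
  assumes "A \<noteq> {}"
  shows "\<forall>\<^sub>F n in sequentially. 1 \<le> ball_count A (real n)"
proof -
  obtain v where v: "v \<in> A" using assms by blast
  have "1 \<le> ball_count A (real n)" if "n \<ge> nat \<lceil>lattice_norm v\<rceil>" for n
  proof -
    have "v \<in> norm_part A {..real n}" using v that by (simp add: norm_part_def)
    then show ?thesis
      unfolding ball_count_def by (metis One_nat_def Suc_leI card_gt_0_iff empty_iff finite_norm_part_atMost)
  qed
  then show ?thesis unfolding eventually_sequentially by blast
qed

lemma norm_part_annulus: "norm_part A {1..r} = norm_part A {..r} - {0}"
  by (auto simp: norm_part_def one_le_lattice_norm_iff)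

lemma card_annulus_le: "card (norm_part A {1..r}) \<le> ball_count A r"
  unfolding norm_part_annulus ball_count_def by (rule card_mono) auto

lemma ball_count_le: "ball_count A r \<le> Suc (card (norm_part A {1..r}))"
  unfolding norm_part_annulus ball_count_def using card_Suc_Diff1[of "norm_part A {..r}" 0]
  by (cases "0 \<in> norm_part A {..r}") auto

text \<open>\<open>n powr (s - t)\<close> tends to 0. Constant factors thus cost only an arbitrarily
  small loss in the exponent.\<close>

lemma eventually_mult_powr_le:
  assumes "s < t"
  shows "\<forall>\<^sub>F n in sequentially. C * real n powr s \<le> real n powr t"
proof -
  have "(\<lambda>n. C * real n powr (s - t)) \<longlonglongrightarrow> C * 0"
    using assms by (intro tendsto_mult_left tendsto_neg_powr filterlim_real_sequentially) simp
  then have "\<forall>\<^sub>F n in sequentially. C * real n powr (s - t) < 1"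
    by (rule order_tendstoD(2)) simp
  then show ?thesis
  proof eventually_elim
    case (elim n)
    then have "C * real n powr (s - t) * real n powr t \<le> 1 * real n powr t"
      by (intro mult_right_mono) auto
    then show ?case by (simp add: mult.assoc flip: powr_add)
  qed
qed

section \<open>Dimensions as growth exponents\<close>

text \<open>Clearing the logarithms turns the liminf into a power bound. The ball count, unlike the
  annulus count, is eventually positive, so this works for empty annuli too.\<close>

lemma lower_zeta_dim_less:
  assumes "ereal s < lower_zeta_dim A" "A \<noteq> {}"
  shows "\<forall>\<^sub>F n in sequentially. real n powr s \<le> real (ball_count A (real n))"
  using less_LiminfD[OF assms(1)[unfolded lower_zeta_dim_def]]
    eventually_ball_count_pos[OF assms(2)] eventually_ge_at_top[of 2]
proof eventually_elim
  case (elim n)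
  let ?N = "card (norm_part A {1..real n})"
  have "log 2 (real ?N) \<le> log 2 (real (ball_count A (real n)))"
  proof (cases "?N = 0")
    case True
    then show ?thesis using elim(2) by (simp add: log_def[of 2 0])
  next
    case False
    then show ?thesis using card_annulus_le[of A "real n"] by (subst log_le_cancel_iff) auto
  qed
  moreover have "s * log 2 (real n) < log 2 (real ?N)"
    using elim by (simp add: pos_less_divide_eq)
  ultimately have "log 2 (real n powr s) \<le> log 2 (real (ball_count A (real n)))"
    using elim by (simp add: log_powr)
  then show ?case using elim by (subst (asm) log_le_cancel_iff) auto
qed

text \<open>For each \<open>s' < s\<close> the gap between the exponents absorbs both
  \<open>C\<close> and the origin, which the annulus count misses.\<close>

lemma le_lower_zeta_dim:
  assumes "\<forall>\<^sub>F n in sequentially. C * real n powr s \<le> real (ball_count A (real n))" "C > 0"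
  shows "ereal s \<le> lower_zeta_dim A"
proof (rule dense_le)
  fix y assume "y < ereal s"
  then obtain s' where s': "y < ereal s'" "s' < s" by (auto dest: ereal_dense2)
  have "\<forall>\<^sub>F n::nat in sequentially. ereal s' \<le>
      ereal (log 2 (real (card (norm_part A {1..real n}))) / log 2 (real n))"
    \<comment> \<open>The constant yields \<open>2 * n powr s' \<le> C * n powr s\<close>; the 2
      pays for the origin, since N + 1 \<le> 2 N for N \<ge> 1.\<close>
    using assms(1) eventually_mult_powr_le[OF s'(2), of "2 / C"] eventually_ge_at_top[of 2]
  proof eventually_elim
    case (elim n)
    let ?N = "card (norm_part A {1..real n})"
    have pos: "0 < real n powr s'" using elim by simp
    have "2 * real n powr s' \<le> C * real n powr s"
      using elim(2) assms(2) by (simp add: field_simps)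
    also have "\<dots> \<le> real (Suc ?N)" using elim(1) ball_count_le[of A "real n"] by linarith
    finally have le: "2 * real n powr s' \<le> real ?N + 1" by simp
    have "s' * log 2 (real n) \<le> log 2 (real ?N)"
    proof (cases "?N = 0")
      \<comment> \<open>Here \<open>log 2 0 = 0\<close>, so \<open>s' * log 2 n\<close> must not be
        positive; indeed \<open>2 * n powr s' \<le> 1\<close>.\<close>
      case True
      then have "real n powr s' \<le> 1" using le by simp
      then have "log 2 (real n powr s') \<le> log 2 1" using pos by (subst log_le_cancel_iff) auto
      then show ?thesis using True elim by (simp add: log_powr log_def)
    next
      case False
      then have "real n powr s' \<le> real ?N" using le by linarith
      then have "log 2 (real n powr s') \<le> log 2 (real ?N)"
        using pos False by (subst log_le_cancel_iff) auto
      then show ?thesis using elim by (simp add: log_powr)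
    qed
    then show ?case using elim by (simp add: pos_le_divide_eq)
  qed
  then have "ereal s' \<le> lower_zeta_dim A"
    unfolding lower_zeta_dim_def by (rule Liminf_bounded)
  then show "y \<le> lower_zeta_dim A" using s' by simp
qed

lemma lower_zeta_dim_nonneg:
  assumes "A \<noteq> {}"
  shows "0 \<le> lower_zeta_dim A"
proof -
  have "\<forall>\<^sub>F n in sequentially. 1 * real n powr 0 \<le> real (ball_count A (real n))"
    using eventually_ball_count_pos[OF assms] by eventually_elim auto
  from le_lower_zeta_dim[OF this] show ?thesis by (simp add: zero_ereal_def)
qed

section \<open>Upper dimension and the zeta series\<close>

lemma upper_zeta_dim_nonneg: "0 \<le> upper_zeta_dim A"
  unfolding upper_zeta_dim_def by (rule Inf_greatest) auto

text \<open>Each point with norm in [1, r] contributes at least \<open>r powr - s\<close> to the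
  series. The \<open>+ 1\<close> covers the origin, because \<open>1 \<le> r powr s\<close>.\<close>

lemma ball_count_le_zeta_fun:
  assumes "zeta_fun A s < \<infinity>" "0 \<le> s" "1 \<le> r"
  shows "real (ball_count A r) \<le> (enn2real (zeta_fun A s) + 1) * r powr s"
proof -
  let ?S = "norm_part A {1..r}"
  let ?N = "card ?S"
  have fin: "finite ?S" by (simp add: norm_part_annulus)
  have "ennreal (real ?N * r powr - s) = (\<Sum>v\<in>?S. ennreal (r powr - s))"
    by (simp add: ennreal_mult ennreal_of_nat_eq_real_of_nat)
  also have "\<dots> \<le> (\<Sum>v\<in>?S. ennreal (lattice_norm v powr - s))"
    using assms by (intro sum_mono ennreal_leI powr_mono2') (auto simp: norm_part_def)
  also have "\<dots> \<le> zeta_fun A s"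
    unfolding zeta_fun_def
    by (subst nonneg_infsum_complete) (use fin in \<open>auto intro!: SUP_upper simp: norm_part_annulus\<close>, auto simp: norm_part_def)
  finally have "ennreal (real ?N * r powr - s) \<le> zeta_fun A s" .
  then have "real ?N * r powr - s \<le> enn2real (zeta_fun A s)"
    using assms(1) by (metis enn2real_ennreal enn2real_mono infinity_ennreal_def mult_nonneg_nonneg
      of_nat_0_le_iff powr_ge_zero)
  then have "real ?N \<le> enn2real (zeta_fun A s) * r powr s"
    using assms(3) by (simp add: powr_minus field_simps)
  moreover have "1 \<le> r powr s" using assms by (simp add: ge_one_powr_ge_zero)
  ultimately show ?thesis using ball_count_le[of A r] by (simp add: algebra_simps)
qed

lemma upper_zeta_dim_less:
  assumes "upper_zeta_dim A < ereal t"
  shows "\<forall>\<^sub>F n in sequentially. real (ball_count A (real n)) \<le> real n powr t"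
proof -
  obtain s where s: "0 \<le> s" "zeta_fun A s < \<infinity>" "s < t"
    using assms unfolding upper_zeta_dim_def Inf_less_iff by auto
  show ?thesis
    using eventually_mult_powr_le[OF s(3), of "enn2real (zeta_fun A s) + 1"] eventually_ge_at_top[of 1]
  proof eventually_elim
    case (elim n)
    then show ?case using ball_count_le_zeta_fun[OF s(2,1), of "real n"] by simp
  qed
qed

text \<open>
  The dyadic comparison: \<open>\<parallel>v\<parallel>\<^sup>-\<^sup>s \<le> 2\<^sup>s \<cdot> 2\<^sup>-\<^sup>k\<^sup>s\<close> for the least \<open>k\<close> with \<open>\<parallel>v\<parallel> \<le> 2\<^sup>k\<close>. Summing over
  all \<open>k\<close> with \<open>\<parallel>v\<parallel> \<le> 2\<^sup>k\<close> instead makes it possible to exchange the two sums.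
\<close>

lemma zeta_fun_finite:
  assumes bound: "\<And>n. n \<ge> 1 \<Longrightarrow> real (ball_count A (real n)) \<le> C * real n powr t"
    and "t < s" "0 \<le> s"
  shows "zeta_fun A s < \<infinity>"
proof -
  \<comment> \<open>The ratio of the dyadic series:
    \<open>(2 ^ k) powr t * (2 ^ k) powr - s = q ^ k\<close>.\<close>
  define q where "q = (2::real) powr (t - s)"
  have q: "0 < q" "q < 1" using \<open>t < s\<close> by (auto simp: q_def powr_less_one)
  have "0 \<le> real (ball_count A (real 1))" by simp
  also have "\<dots> \<le> C" using bound[of 1] by simp
  finally have C: "0 \<le> C" .
  \<comment> \<open>\<open>2 powr s\<close> is the price of replacing a norm by a power of 2 at most
    twice as large; the other factor sums the geometric series.\<close>
  define D where "D = 2 powr s * (C * (1 / (1 - q)))"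
  have "(\<Sum>v\<in>F. lattice_norm v powr - s) \<le> D" if F: "finite F" "F \<subseteq> A - {0}" for F
  proof -
    have "\<exists>k. v \<noteq> 0 \<longrightarrow> lattice_norm v \<le> 2 ^ k \<and> 2 ^ k \<le> 2 * lattice_norm v" for v :: "int ^ 'a"
    proof (cases "v = 0")
      case True
      then show ?thesis by simp
    next
      case False
      let ?P = "\<lambda>k. lattice_norm v \<le> 2 ^ k"
      have ex: "\<exists>k. ?P k" using real_arch_pow[of 2 "lattice_norm v"] by (auto intro: less_imp_le)
      show ?thesis
      proof (cases "Least ?P")
        case 0
        then have "?P 0" using LeastI_ex[OF ex] by simp
        then show ?thesis using False one_le_lattice_norm_iff[of v] by (intro exI[of _ 0]) auto
      next
        case (Suc k)
        then have "\<not> ?P k" by (intro not_less_Least) simp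
        then show ?thesis using LeastI_ex[OF ex] Suc by (intro exI[of _ "Suc k"]) auto
      qed
    qed
    then obtain \<kappa> where \<kappa>: "\<And>v :: int ^ 'a. v \<noteq> 0 \<Longrightarrow> lattice_norm v \<le> 2 ^ \<kappa> v \<and> 2 ^ \<kappa> v \<le> 2 * lattice_norm v"
      by metis
    \<comment> \<open>A common bound for the exponents on the finite set \<open>F\<close> keeps the
      dyadic sums finite, so that they can be exchanged with the sum over \<open>F\<close>.\<close>
    obtain K where K: "\<And>v. v \<in> F \<Longrightarrow> \<kappa> v < K"
      using finite_nat_bounded[of "\<kappa> ` F"] F(1) by auto
    let ?w = "\<lambda>k. (2 ^ k :: real) powr - s"
    let ?i = "\<lambda>v k. if lattice_norm v \<le> 2 ^ k then ?w k else 0"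
    have "(\<Sum>v\<in>F. lattice_norm v powr - s) \<le> (\<Sum>v\<in>F. 2 powr s * (\<Sum>k<K. ?i v k))"
    proof (rule sum_mono)
      fix v assume v: "v \<in> F"
      then have nz: "v \<noteq> 0" using F by auto
      have "lattice_norm v powr - s = 2 powr s * (2 * lattice_norm v) powr - s"
        by (simp add: powr_mult powr_minus)
      also have "\<dots> \<le> 2 powr s * ?w (\<kappa> v)"
        using \<kappa>[OF nz] \<open>0 \<le> s\<close> by (intro mult_left_mono powr_mono2') auto
      also have "?w (\<kappa> v) = ?i v (\<kappa> v)" using \<kappa>[OF nz] by simp
      also have "\<dots> \<le> (\<Sum>k<K. ?i v k)" using K[OF v] by (intro member_le_sum) auto
      finally show "lattice_norm v powr - s \<le> 2 powr s * (\<Sum>k<K. ?i v k)" by simp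
    qed
    also have "\<dots> = 2 powr s * (\<Sum>k<K. \<Sum>v\<in>F. ?i v k)"
      by (simp add: sum_distrib_left[symmetric] sum.swap[of _ F])
    also have "\<dots> \<le> 2 powr s * (\<Sum>k<K. C * q ^ k)"
    proof (intro mult_left_mono sum_mono)
      fix k
      have "(\<Sum>v\<in>F. ?i v k) = real (card {v\<in>F. lattice_norm v \<le> 2 ^ k}) * ?w k"
        using F(1) by (simp add: sum.If_cases Int_def)
      also have "\<dots> \<le> real (ball_count A (real (2 ^ k))) * ?w k"
        unfolding ball_count_def
        using F(2) by (intro mult_right_mono of_nat_mono card_mono finite_norm_part_atMost) (auto simp: norm_part_def)
      also have "\<dots> \<le> (C * real (2 ^ k) powr t) * ?w k"
        by (intro mult_right_mono bound) auto
      also have "\<dots> = C * (2 ^ k) powr (t - s)"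
        by (simp add: powr_diff powr_minus field_simps)
      also have "(2 ^ k :: real) powr (t - s) = q ^ k"
        by (simp add: q_def powr_realpow[symmetric] powr_powr mult.commute)
      finally show "(\<Sum>v\<in>F. ?i v k) \<le> C * q ^ k" .
    qed simp
    also have "\<dots> \<le> D"
      unfolding D_def sum_distrib_left[symmetric]
    proof (intro mult_left_mono)
      have "(\<Sum>k<K. q ^ k) \<le> (\<Sum>k. q ^ k)"
        using q by (intro sum_le_suminf summable_geometric) auto
      then show "(\<Sum>k<K. q ^ k) \<le> 1 / (1 - q)" using q by (simp add: suminf_geometric)
    qed (use C in auto)
    finally show ?thesis .
  qed
  \<comment> \<open>A sum of nonnegative terms is the supremum of its finite partial sums, and
    \<open>D\<close> does not depend on \<open>F\<close>.\<close>
  then have "zeta_fun A s \<le> ennreal D"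
    unfolding zeta_fun_def
    by (subst nonneg_infsum_complete) (auto intro!: SUP_least ennreal_leI simp: sum_ennreal)
  also have "\<dots> < \<infinity>" by simp
  finally show ?thesis .
qed

text \<open>Once the bound is extended to all n \<ge> 1, the series converges for every s > t.
  Nonemptiness forces t \<ge> 0, so these s are admissible in the infimum.\<close>

lemma upper_zeta_dim_le:
  assumes ev: "\<forall>\<^sub>F n in sequentially. real (ball_count A (real n)) \<le> C * real n powr t"
    and "A \<noteq> {}"
  shows "upper_zeta_dim A \<le> ereal t"
proof -
  have t: "0 \<le> t"
  proof (rule ccontr)
    assume "\<not> 0 \<le> t"
    then have "t < 0" by simp
    have "\<forall>\<^sub>F n in sequentially. False"
      \<comment> \<open>The factor 2 makes \<open>C * n powr t\<close> eventually at most 1/2, while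
        the count is at least 1.\<close>
      using eventually_mult_powr_le[OF \<open>t < 0\<close>, of "2 * C"] ev
        eventually_ball_count_pos[OF assms(2)] eventually_ge_at_top[of 1]
    proof eventually_elim
      case (elim n)
      then have "1 \<le> C * real n powr t" "2 * (C * real n powr t) \<le> 1" by simp_all
      then show False by linarith
    qed
    then show False by simp
  qed
  obtain N where N: "\<And>n. n \<ge> N \<Longrightarrow> real (ball_count A (real n)) \<le> C * real n powr t"
    using ev by (auto simp: eventually_sequentially)
  \<comment> \<open>Below the threshold \<open>N\<close> the count is at most its value at
    \<open>N\<close>, and \<open>n powr t \<ge> 1\<close> since t \<ge> 0.\<close>
  define C' where "C' = max C (real (ball_count A (real N)))"
  have bound: "real (ball_count A (real n)) \<le> C' * real n powr t" if "n \<ge> 1" for n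
  proof (cases "n \<ge> N")
    case True
    have "C * real n powr t \<le> C' * real n powr t"
      by (intro mult_right_mono) (auto simp: C'_def)
    then show ?thesis using N[OF True] by linarith
  next
    case False
    have "real (ball_count A (real n)) \<le> real (ball_count A (real N))"
      using False by (intro of_nat_mono ball_count_mono) auto
    also have "\<dots> \<le> C' * 1" by (simp add: C'_def)
    also have "\<dots> \<le> C' * real n powr t"
      using that t by (intro mult_left_mono ge_one_powr_ge_zero) (auto simp: C'_def le_max_iff_disj)
    finally show ?thesis .
  qed
  show ?thesis
  proof (rule dense_ge)
    fix y assume "ereal t < y"
    then obtain s where s: "t < s" "ereal s < y" by (auto dest: ereal_dense2)
    have "upper_zeta_dim A \<le> ereal s"
      unfolding upper_zeta_dim_def
      using zeta_fun_finite[OF bound s(1)] s t by (intro Inf_lower) auto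
    then show "upper_zeta_dim A \<le> y" using s by simp
  qed
qed

section \<open>Products\<close>

lemma lattice_norm_vec_append:
  "(lattice_norm (vec_append x y))\<^sup>2 = (lattice_norm x)\<^sup>2 + (lattice_norm y)\<^sup>2"
proof -
  have "(\<Sum>i\<in>UNIV. (real_of_int (vec_append x y $ i))\<^sup>2)
      = (\<Sum>i\<in>UNIV <+> UNIV. (real_of_int (vec_append x y $ i))\<^sup>2)"
    by simp
  also have "\<dots> = (\<Sum>i\<in>UNIV. (real_of_int (x $ i))\<^sup>2) + (\<Sum>i\<in>UNIV. (real_of_int (y $ i))\<^sup>2)"
    by (subst sum.Plus) (simp_all add: vec_append_def)
  finally show ?thesis by (simp add: lattice_norm_def sum_nonneg)
qed

lemma inj_vec_append: "inj (\<lambda>(x, y). vec_append x y)"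
proof (rule injI, clarsimp)
  fix x x' :: "int ^ 'a" and y y' :: "int ^ 'b"
  assume eq: "vec_append x y = vec_append x' y'"
  have "vec_append x y $ Inl i = vec_append x' y' $ Inl i"
    "vec_append x y $ Inr j = vec_append x' y' $ Inr j" for i j
    using eq by simp_all
  then show "x = x' \<and> y = y'" by (simp add: vec_append_def vec_eq_iff)
qed

text \<open>Concatenation is injective, and a^2 + b^2 \<le> (a + b)^2 keeps the norm of a
  concatenation below the sum of the two norms.\<close>

lemma ball_count_prod_ge:
  "ball_count A r * ball_count B r \<le> ball_count (lattice_prod A B) (2 * r)"
proof -
  have "(\<lambda>(x, y). vec_append x y) ` (norm_part A {..r} \<times> norm_part B {..r})
      \<subseteq> norm_part (lattice_prod A B) {..2 * r}"
  proof clarsimp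
    fix x y assume "x \<in> norm_part A {..r}" "y \<in> norm_part B {..r}"
    then have *: "x \<in> A" "y \<in> B" "lattice_norm x \<le> r" "lattice_norm y \<le> r"
      by (auto simp: norm_part_def)
    have "(lattice_norm (vec_append x y))\<^sup>2 \<le> (lattice_norm x + lattice_norm y)\<^sup>2"
      by (simp add: lattice_norm_vec_append power2_sum)
    then have "lattice_norm (vec_append x y) \<le> lattice_norm x + lattice_norm y"
      by (rule power2_le_imp_le) simp
    then show "vec_append x y \<in> norm_part (lattice_prod A B) {..2 * r}"
      using * by (auto simp: norm_part_def lattice_prod_def)
  qed
  from card_mono[OF _ this] show ?thesis
    by (simp add: ball_count_def card_image[OF inj_on_subset[OF inj_vec_append subset_UNIV]] card_cartesian_product)
qed

text \<open>Neither block of coordinates has larger norm than the whole vector.\<close>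

lemma ball_count_prod_le:
  "ball_count (lattice_prod A B) r \<le> ball_count A r * ball_count B r"
proof -
  have "norm_part (lattice_prod A B) {..r}
      \<subseteq> (\<lambda>(x, y). vec_append x y) ` (norm_part A {..r} \<times> norm_part B {..r})"
  proof
    fix z assume "z \<in> norm_part (lattice_prod A B) {..r}"
    then obtain x y where *: "z = vec_append x y" "x \<in> A" "y \<in> B" "lattice_norm (vec_append x y) \<le> r"
      by (auto simp: norm_part_def lattice_prod_def)
    have "lattice_norm x \<le> lattice_norm (vec_append x y)" "lattice_norm y \<le> lattice_norm (vec_append x y)"
      by (rule power2_le_imp_le; simp add: lattice_norm_vec_append)+
    then show "z \<in> (\<lambda>(x, y). vec_append x y) ` (norm_part A {..r} \<times> norm_part B {..r})"
      using * by (auto simp: norm_part_def)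
  qed
  from card_mono[OF _ this] show ?thesis
    by (simp add: ball_count_def card_image[OF inj_on_subset[OF inj_vec_append subset_UNIV]] card_cartesian_product)
qed

text \<open>A real x strictly between c and a + b can be split as x \<le> s + t with s < a and t <
  b. Nonnegativity leaves a real bound below each summand even if the other is infinite.\<close>

lemma ereal_add_le_dense:
  fixes a b c :: ereal
  assumes "0 \<le> a" "0 \<le> b" "\<And>s t. ereal s < a \<Longrightarrow> ereal t < b \<Longrightarrow> ereal (s + t) \<le> c"
  shows "a + b \<le> c"
proof (rule ccontr)
  assume "\<not> a + b \<le> c"
  then have "c < a + b" by simp
  then obtain x where x: "c < ereal x" "ereal x < a + b" using ereal_dense2 by blast
  have "\<exists>s t. ereal s < a \<and> ereal t < b \<and> x \<le> s + t"
  proof (cases "a = \<infinity>")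
    case True
    \<comment> \<open>Any real below \<open>b\<close> serves, as the infinite \<open>a\<close>
      admits the compensating \<open>x + 1\<close>.\<close>
    moreover have "ereal (-1) < b" using assms(2) by (rule less_le_trans[rotated]) simp
    ultimately show ?thesis by (intro exI[of _ "x + 1"] exI[of _ "-1"]) auto
  next
    case False
    then obtain a' where a: "a = ereal a'" using assms(1) by (cases a) auto
    have "ereal (x - a') < b" using x(2) a by (cases b) auto
    \<comment> \<open>Strictness on the left leaves \<open>x - t\<close> below
      \<open>a'\<close>.\<close>
    then obtain t where t: "x - a' < t" "ereal t < b" by (auto dest: ereal_dense2)
    then show ?thesis by (intro exI[of _ "x - t"] exI[of _ t]) (auto simp: a)
  qed
  then obtain s t where "ereal s < a" "ereal t < b" "x \<le> s + t" by blast
  then have "ereal x \<le> c" using assms(3) by (meson ereal_less_eq(3) order_trans)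
  then show False using x by simp
qed

lemma ereal_le_add_dense:
  fixes a b c :: ereal
  assumes "0 \<le> a" "0 \<le> b" "\<And>s t. a < ereal s \<Longrightarrow> b < ereal t \<Longrightarrow> c \<le> ereal (s + t)"
  shows "c \<le> a + b"
proof (cases "a + b = \<infinity>")
  case False
  then obtain a' b' where ab: "a = ereal a'" "b = ereal b'"
    using assms(1,2) by (cases a; cases b) auto
  show ?thesis
  proof (rule ereal_le_epsilon2)
    fix e :: real assume "0 < e"
    then have "c \<le> ereal ((a' + e / 2) + (b' + e / 2))" by (intro assms(3)) (auto simp: ab)
    then show "c \<le> a + b + ereal e" by (simp add: ab algebra_simps)
  qed
qed (simp only: ereal_less_eq(1))

lemma lattice_prod_nonempty: "A \<noteq> {} \<Longrightarrow> B \<noteq> {} \<Longrightarrow> lattice_prod A B \<noteq> {}"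
  by (auto simp: lattice_prod_def)

lemma filterlim_div_2_at_top: "filterlim (\<lambda>n::nat. n div 2) sequentially sequentially"
  by (rule filterlim_at_top_div_const_nat) simp

text \<open>Halving the radius costs a constant factor: \<open>n \<le> 3 * (n div 2)\<close> settles
  u \<ge> 0. For u < 0 the power is antitone and the prefactor is at most 1.\<close>

lemma powr_div_2_ge:
  assumes "2 \<le> n"
  shows "3 powr (- \<bar>u\<bar>) * real n powr u \<le> real (n div 2) powr u"
proof (cases "u \<ge> 0")
  case True
  have "3 powr (- \<bar>u\<bar>) * real n powr u = (real n / 3) powr u"
    using True by (simp add: powr_divide powr_minus field_simps)
  also have "\<dots> \<le> real (n div 2) powr u"
  proof (intro powr_mono2)
    have "n \<le> 3 * (n div 2)" using assms by presburger
    then show "real n / 3 \<le> real (n div 2)" by linarith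
  qed (use True in auto)
  finally show ?thesis .
next
  case False
  have "3 powr (- \<bar>u\<bar>) * real n powr u \<le> 1 * real n powr u"
    using powr_mono[of "- \<bar>u\<bar>" 0 "3::real"] by (intro mult_right_mono) auto
  also have "\<dots> \<le> real (n div 2) powr u"
    using assms False by (simp, intro powr_mono2') auto
  finally show ?thesis .
qed

section \<open>The four inequalities\<close>

text \<open>At radius \<open>n div 2\<close> both counts satisfy their lower power bounds, and the
  product of the two balls fits into radius \<open>n\<close>.\<close>

lemma lower_add_lower_le:
  assumes "A \<noteq> {}" "B \<noteq> {}"
  shows "lower_zeta_dim A + lower_zeta_dim B \<le> lower_zeta_dim (lattice_prod A B)"
proof (rule ereal_add_le_dense)
  fix s t assume s: "ereal s < lower_zeta_dim A" and t: "ereal t < lower_zeta_dim B"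
  have "\<forall>\<^sub>F n in sequentially.
      3 powr (- \<bar>s + t\<bar>) * real n powr (s + t) \<le> real (ball_count (lattice_prod A B) (real n))"
    using eventually_compose_filterlim[OF lower_zeta_dim_less[OF s assms(1)] filterlim_div_2_at_top]
      eventually_compose_filterlim[OF lower_zeta_dim_less[OF t assms(2)] filterlim_div_2_at_top]
      eventually_ge_at_top[of 2]
  proof eventually_elim
    case (elim n)
    let ?m = "real (n div 2)"
    have "3 powr (- \<bar>s + t\<bar>) * real n powr (s + t) \<le> ?m powr (s + t)"
      by (rule powr_div_2_ge[OF elim(3)])
    also have "\<dots> = ?m powr s * ?m powr t" by (rule powr_add)
    also have "\<dots> \<le> real (ball_count A ?m) * real (ball_count B ?m)"
      using elim by (intro mult_mono) auto
    also have "\<dots> \<le> real (ball_count (lattice_prod A B) (2 * ?m))"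
      using ball_count_prod_ge[of A ?m B] by (simp flip: of_nat_mult)
    also have "\<dots> \<le> real (ball_count (lattice_prod A B) (real n))"
      by (intro of_nat_mono ball_count_mono) linarith
    finally show ?case .
  qed
  then show "ereal (s + t) \<le> lower_zeta_dim (lattice_prod A B)"
    by (rule le_lower_zeta_dim) simp
qed (simp_all add: assms lower_zeta_dim_nonneg)

text \<open>Otherwise the product count is eventually at least \<open>n powr (s + t)\<close>;
  dividing by the bound \<open>n powr t\<close> for \<open>B\<close> gives \<open>A\<close> the
  growth exponent s, above its lower dimension. The bound for \<open>B\<close> is used at all large
  radii, hence the upper dimension.\<close>

lemma lower_prod_le:
  assumes "A \<noteq> {}" "B \<noteq> {}"
  shows "lower_zeta_dim (lattice_prod A B) \<le> lower_zeta_dim A + upper_zeta_dim B"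
proof (rule ereal_le_add_dense)
  fix s t assume s: "lower_zeta_dim A < ereal s" and t: "upper_zeta_dim B < ereal t"
  show "lower_zeta_dim (lattice_prod A B) \<le> ereal (s + t)"
  proof (rule ccontr)
    assume "\<not> ?thesis"
    then have "ereal (s + t) < lower_zeta_dim (lattice_prod A B)" by simp
    from lower_zeta_dim_less[OF this lattice_prod_nonempty[OF assms]]
      upper_zeta_dim_less[OF t] eventually_ge_at_top[of 1]
    have "\<forall>\<^sub>F n in sequentially. 1 * real n powr s \<le> real (ball_count A (real n))"
    proof eventually_elim
      case (elim n)
      have "real n powr s * real n powr t \<le> real (ball_count (lattice_prod A B) (real n))"
        using elim by (simp flip: powr_add)
      also have "\<dots> \<le> real (ball_count A (real n)) * real (ball_count B (real n))"
        using ball_count_prod_le[of A B "real n"] by (simp flip: of_nat_mult)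
      also have "\<dots> \<le> real (ball_count A (real n)) * real n powr t"
        using elim by (intro mult_left_mono) auto
      finally show ?case using elim by simp
    qed
    from le_lower_zeta_dim[OF this] s show False by simp
  qed
qed (simp_all add: assms lower_zeta_dim_nonneg upper_zeta_dim_nonneg)

text \<open>Otherwise the product count at radius \<open>2 * n\<close> is at most
  \<open>(2 * n) powr (s + t)\<close>; dividing by the lower bound \<open>n powr s\<close> for
  \<open>A\<close> bounds \<open>B\<close> by a multiple of \<open>n powr t\<close>, although t lies
  below its upper dimension.\<close>

lemma lower_add_upper_le:
  assumes "A \<noteq> {}" "B \<noteq> {}"
  shows "lower_zeta_dim A + upper_zeta_dim B \<le> upper_zeta_dim (lattice_prod A B)"
proof (rule ereal_add_le_dense)
  fix s t assume s: "ereal s < lower_zeta_dim A" and t: "ereal t < upper_zeta_dim B"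
  show "ereal (s + t) \<le> upper_zeta_dim (lattice_prod A B)"
  proof (rule ccontr)
    assume "\<not> ?thesis"
    then have u: "upper_zeta_dim (lattice_prod A B) < ereal (s + t)" by simp
    have "filterlim (\<lambda>n::nat. 2 * n) sequentially sequentially"
      by (rule filterlim_subseq) (simp add: strict_mono_def)
    note eventually_compose_filterlim[OF upper_zeta_dim_less[OF u] this]
    with lower_zeta_dim_less[OF s assms(1)] eventually_ge_at_top[of 1]
    have "\<forall>\<^sub>F n in sequentially. real (ball_count B (real n)) \<le> 2 powr (s + t) * real n powr t"
    proof eventually_elim
      case (elim n)
      have "real n powr s * real (ball_count B (real n))
          \<le> real (ball_count A (real n)) * real (ball_count B (real n))"
        using elim by (intro mult_right_mono) auto
      also have "\<dots> \<le> real (ball_count (lattice_prod A B) (2 * real n))"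
        using ball_count_prod_ge[of A "real n" B] by (simp flip: of_nat_mult)
      also have "\<dots> \<le> (2 * real n) powr (s + t)" using elim by simp
      also have "\<dots> = real n powr s * (2 powr (s + t) * real n powr t)"
        by (simp add: powr_mult powr_add)
      finally show ?case using elim by simp
    qed
    from upper_zeta_dim_le[OF this assms(2)] t show False by simp
  qed
qed (simp_all add: assms lower_zeta_dim_nonneg upper_zeta_dim_nonneg)

lemma upper_prod_le:
  assumes "A \<noteq> {}" "B \<noteq> {}"
  shows "upper_zeta_dim (lattice_prod A B) \<le> upper_zeta_dim A + upper_zeta_dim B"
proof (rule ereal_le_add_dense)
  fix s t assume s: "upper_zeta_dim A < ereal s" and t: "upper_zeta_dim B < ereal t"
  have "\<forall>\<^sub>F n in sequentially.
      real (ball_count (lattice_prod A B) (real n)) \<le> 1 * real n powr (s + t)"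
    using upper_zeta_dim_less[OF s] upper_zeta_dim_less[OF t]
  proof eventually_elim
    case (elim n)
    have "real (ball_count (lattice_prod A B) (real n))
        \<le> real (ball_count A (real n)) * real (ball_count B (real n))"
      using ball_count_prod_le[of A B "real n"] by (simp flip: of_nat_mult)
    also have "\<dots> \<le> real n powr s * real n powr t"
      using elim by (intro mult_mono) auto
    finally show ?case by (simp add: powr_add)
  qed
  then show "upper_zeta_dim (lattice_prod A B) \<le> ereal (s + t)"
    by (rule upper_zeta_dim_le[OF _ lattice_prod_nonempty[OF assms]])
qed (simp_all add: upper_zeta_dim_nonneg)

text \<open>The empty set is excluded because both of its dimensions, and those of a product with
  it, are 0: the first inequality would fail if the other factor had positive lower
  dimension.\<close>

theorem theorem3p7:
  fixes A :: "(int ^ 'm) set" and B :: "(int ^ 'n) set"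
  assumes "A \<noteq> {}" and "B \<noteq> {}"
  shows "lower_zeta_dim A + lower_zeta_dim B \<le> lower_zeta_dim (lattice_prod A B)
    \<and> lower_zeta_dim (lattice_prod A B) \<le> lower_zeta_dim A + upper_zeta_dim B
    \<and> lower_zeta_dim A + upper_zeta_dim B \<le> upper_zeta_dim (lattice_prod A B)
    \<and> upper_zeta_dim (lattice_prod A B) \<le> upper_zeta_dim A + upper_zeta_dim B"
  using lower_add_lower_le[OF assms] lower_prod_le[OF assms] lower_add_upper_le[OF assms]
    upper_prod_le[OF assms] by simp

end
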